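(* Let $\mathcal H$ be a real Hilbert space and let $\Phi:\mathcal H\to\mathbb R$ be continuously differentiable and strongly convex. Let $t_0>0$, $\alpha>3$, and let $x:[t_0,+\infty[\to\mathcal H$ be a solution of $$\ddot x(t)+\frac{\alpha}{t}\dot x(t)+\nabla\Phi(x(t))=0 .$$ Then $x(t)$ converges strongly, as $t\to+\infty$, to the unique element $x^*\in\operatorname{argmin}\Phi$. Moreover, as $t\to+\infty$, $$\Phi(x(t))-\min\Phi=\mathcal O\big(t^{-\frac23\alpha}\big),\qquad \|x(t)-x^*\|^2=\mathcal O\big(t^{-\frac23\alpha}\big),\qquad \|\dot x(t)\|^2=\mathcal O\big(t^{-\frac23\alpha}\big).$$
   Context: $\Phi$ is strongly convex if there exists $\mu>0$ such that $\Phi(y)\ge\Phi(x)+\langle\nabla\Phi(x),y-x\rangle+\frac{\mu}{2}\|x-y\|^2$ for all $x,y\in\mathcal H$. A solution on $[t_0,+\infty[$ is a twice continuously differentiable function $x:[t_0,+\infty[\to\mathcal H$ satisfying the equation for all $t\ge t_0$. $\operatorname{argmin}\Phi$ denotes the set of global minimizers of $\Phi$. Strong convergence means convergence in norm. *)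

theory Defs
  imports "HOL-Analysis.Analysis" "HOL-Library.Landau_Symbols"
begin

text \<open>A real Hilbert space is a type of sort \<open>{real_inner, complete_space}\<close>; no restriction on the
  dimension or on separability is implied.\<close>

text \<open>The definite description is justified by \<open>gradient_eqI\<close> below (uniqueness) and, at points of
  Frechet differentiability in a complete space, by the Riesz representation theorem (existence).\<close>

definition gradient :: "('a::real_inner \<Rightarrow> real) \<Rightarrow> 'a \<Rightarrow> 'a" where
  "gradient \<Phi> x = (THE g. GDERIV \<Phi> x :> g)"

lemma gradient_eqI:
  assumes "GDERIV \<Phi> x :> g"
  shows "gradient \<Phi> x = g"
  unfolding gradient_def
proof (rule the_equality)
  show "GDERIV \<Phi> x :> g" by (fact assms)
next
  fix h assume "GDERIV \<Phi> x :> h"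
  with assms have "(\<lambda>v. inner v h) = (\<lambda>v. inner v g)"
    unfolding gderiv_def by (metis has_derivative_unique)
  then have "inner v h = inner v g" for v
    by (rule fun_cong)
  then show "h = g"
    by (metis vector_eq_rdot inner_commute)
qed

text \<open>Continuity of the Frechet derivative is with respect to the operator norm.\<close>

definition continuously_differentiable :: "('a::real_normed_vector \<Rightarrow> real) \<Rightarrow> bool" where
  "continuously_differentiable \<Phi> \<longleftrightarrow>
    (\<exists>D :: 'a \<Rightarrow> 'a \<Rightarrow>\<^sub>L real.
      (\<forall>x. (\<Phi> has_derivative blinfun_apply (D x)) (at x)) \<and> continuous_on UNIV D)"

definition strongly_convex :: "('a::real_inner \<Rightarrow> real) \<Rightarrow> bool" where
  "strongly_convex \<Phi> \<longleftrightarrow>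
    (\<exists>\<mu>>0. \<forall>x y. \<Phi> y \<ge> \<Phi> x + inner (gradient \<Phi> x) (y - x) + \<mu> / 2 * (norm (x - y))\<^sup>2)"

definition argmin_set :: "('a \<Rightarrow> real) \<Rightarrow> 'a set" where
  "argmin_set \<Phi> = {z. \<forall>y. \<Phi> z \<le> \<Phi> y}"

text \<open>The function \<open>x\<close> is twice continuously differentiable on the half-line starting at \<open>t0\<close>, with first
  and second derivatives \<open>x'\<close> and \<open>x''\<close>. Derivatives are taken within the half-line, hence one-sided
  at \<open>t0\<close>; the values of the three functions to the left of \<open>t0\<close> are irrelevant.\<close>

definition C2_on_halfline ::
  "real \<Rightarrow> (real \<Rightarrow> 'a::real_normed_vector) \<Rightarrow> (real \<Rightarrow> 'a) \<Rightarrow> (real \<Rightarrow> 'a) \<Rightarrow> bool" where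
  "C2_on_halfline t0 x x' x'' \<longleftrightarrow>
    (\<forall>t\<ge>t0. (x has_vector_derivative x' t) (at t within {t0..})) \<and>
    (\<forall>t\<ge>t0. (x' has_vector_derivative x'' t) (at t within {t0..})) \<and>
    continuous_on {t0..} x''"

end

theory Submission
  imports Defs
begin

text \<open>The proof uses the Lyapunov function
  \<open>E(t) = t\<^sup>p (t\<^sup>2 (\<Phi>(x) - min \<Phi>) + \<bar>\<theta> (x - x\<^sub>s) + t x'\<bar>\<^sup>2 / 2)\<close> with
  \<open>\<theta> = 2\<alpha>/3\<close> and \<open>p = \<theta> - 2\<close>, the exponents for which the terms in \<open>\<Phi>(x) - min \<Phi>\<close> and in
  \<open>\<bar>x'\<bar>\<^sup>2\<close> cancel in \<open>E'\<close>. The remaining cross term is a multiple of the derivative of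
  \<open>\<bar>x - x\<^sub>s\<bar>\<^sup>2\<close>; subtracting \<open>c t\<^sup>p \<bar>x - x\<^sub>s\<bar>\<^sup>2\<close> from \<open>E\<close> absorbs it, and strong convexity
  makes what is left of the derivative nonpositive for large \<open>t\<close>. Since \<open>\<bar>x - x\<^sub>s\<bar>\<^sup>2\<close> is at most a
  multiple of \<open>\<Phi>(x) - min \<Phi>\<close>, the subtracted term is of lower order, so \<open>E\<close> is bounded.\<close>

text \<open>The map \<open>g\<close> is arbitrary, so the inequality can be used before
  \<open>g x\<close> is known to be a derivative, and \<mu> is a parameter so that it can be shared
  between lemmas.\<close>

definition strong_subgradient ::
  "real \<Rightarrow> ('a::real_inner \<Rightarrow> real) \<Rightarrow> ('a \<Rightarrow> 'a) \<Rightarrow> bool" where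
  "strong_subgradient \<mu> \<Phi> g \<longleftrightarrow>
    (\<forall>x y. \<Phi> y \<ge> \<Phi> x + inner (g x) (y - x) + \<mu> / 2 * (norm (x - y))\<^sup>2)"

lemma strong_subgradientD:
  "strong_subgradient \<mu> \<Phi> g \<Longrightarrow> \<Phi> x + inner (g x) (y - x) + \<mu> / 2 * (norm (x - y))\<^sup>2 \<le> \<Phi> y"
  by (auto simp: strong_subgradient_def)

text \<open>\<Phi> minus its affine minorant touching at \<open>x\<close> has a minimum there, so
  its derivative vanishes and \<open>g\<close> represents \<open>D\<close>.\<close>

lemma GDERIV_subgradient:
  fixes \<Phi> :: "'a::real_inner \<Rightarrow> real"
  assumes D: "(\<Phi> has_derivative D) (at x)"
    and sub: "\<And>y. \<Phi> y \<ge> \<Phi> x + inner g (y - x)"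
  shows "GDERIV \<Phi> x :> g"
proof -
  define h where "h y = \<Phi> y - inner g (y - x)" for y
  have dh: "(h has_derivative (\<lambda>v. D v - inner g v)) (at x)"
    unfolding h_def by (auto intro!: derivative_eq_intros D)
  have "(\<lambda>v. D v - inner g v) = (\<lambda>v. 0)"
  proof (rule differential_zero_maxmin[OF _ _ dh])
    show "(\<forall>y\<in>UNIV. h y \<le> h x) \<or> (\<forall>y\<in>UNIV. h x \<le> h y)"
      using sub by (auto simp: h_def algebra_simps)
  qed auto
  then have "D = (\<lambda>v. inner v g)"
    by (auto simp: fun_eq_iff inner_commute)
  with D show ?thesis by (simp add: gderiv_def)
qed

text \<open>The subgradient inequalities based at the midpoint are added for the targets
  \<open>x\<close> and \<open>y\<close>; the linear terms cancel because the two displacements are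
  opposite.\<close>

lemma strong_subgradient_midpoint:
  fixes \<Phi> :: "'a::real_inner \<Rightarrow> real"
  assumes "strong_subgradient \<mu> \<Phi> g"
  shows "2 * \<Phi> (midpoint x y) + \<mu> / 4 * (norm (x - y))\<^sup>2 \<le> \<Phi> x + \<Phi> y"
proof -
  define m where "m = midpoint x y"
  have mx: "m - x = (1/2) *\<^sub>R (y - x)" and my: "m - y = (1/2) *\<^sub>R (x - y)"
    and xm: "x - m = - (y - m)"
    by (auto simp: m_def midpoint_def algebra_simps simp flip: scaleR_add_left)
  have nx: "(norm (m - x))\<^sup>2 = (norm (x - y))\<^sup>2 / 4" and ny: "(norm (m - y))\<^sup>2 = (norm (x - y))\<^sup>2 / 4"
    unfolding mx my by (auto simp: power_divide norm_minus_commute)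
  show ?thesis
    using strong_subgradientD[OF assms, of m x] strong_subgradientD[OF assms, of m y]
    unfolding nx ny xm m_def[symmetric] inner_minus_right by simp
qed

text \<open>By Cauchy-Schwarz the minorant based at 0 is bounded below by a quadratic polynomial in
  \<open>norm y\<close>; completing the square bounds that from below.\<close>

lemma strong_subgradient_bdd_below:
  fixes \<Phi> :: "'a::real_inner \<Rightarrow> real"
  assumes "strong_subgradient \<mu> \<Phi> g" "\<mu> > 0"
  shows "bdd_below (range \<Phi>)"
proof (rule bdd_belowI2)
  fix y
  have "- (norm (g 0) * norm y) \<le> inner (g 0) y"
    using Cauchy_Schwarz_ineq2[of "g 0" y] by linarith
  moreover have "(norm (g 0))\<^sup>2 / (2 * \<mu>) - norm (g 0) * norm y + \<mu> / 2 * (norm y)\<^sup>2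
      = (norm (g 0) - \<mu> * norm y)\<^sup>2 / (2 * \<mu>)"
    using \<open>\<mu> > 0\<close> by (simp add: field_simps power2_eq_square)
  moreover have "\<dots> \<ge> 0" using \<open>\<mu> > 0\<close> by simp
  ultimately show "\<Phi> 0 - (norm (g 0))\<^sup>2 / (2 * \<mu>) \<le> \<Phi> y"
    using strong_subgradientD[OF assms(1), of 0 y] by simp
qed

text \<open>The midpoint inequality makes a minimizing sequence Cauchy, so completeness yields a
  limit without any compactness; continuity makes this limit a minimizer.\<close>

lemma strong_subgradient_ex_minimizer:
  fixes \<Phi> :: "'a::{real_inner, complete_space} \<Rightarrow> real"
  assumes sub: "strong_subgradient \<mu> \<Phi> g" and \<mu>: "\<mu> > 0" and cont: "continuous_on UNIV \<Phi>"
  obtains z where "\<And>y. \<Phi> z \<le> \<Phi> y"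
proof -
  define m where "m = (INF y. \<Phi> y)"
  have bdd: "bdd_below (range \<Phi>)" using strong_subgradient_bdd_below[OF sub \<mu>] .
  have m_le: "m \<le> \<Phi> y" for y unfolding m_def by (rule cINF_lower[OF bdd]) simp
  have "\<exists>y. \<Phi> y < m + inverse (real (Suc n))" for n
    using cINF_less_iff[OF _ bdd, of "m + inverse (real (Suc n))"] by (auto simp: m_def)
  then obtain s where s: "\<And>n. \<Phi> (s n) < m + inverse (real (Suc n))" by metis
  have lim: "(\<lambda>n. \<Phi> (s n)) \<longlonglongrightarrow> m"
  proof (rule tendsto_sandwich[of "\<lambda>_. m"])
    show "(\<lambda>n. m + inverse (real (Suc n))) \<longlonglongrightarrow> m"
      using tendsto_add[OF tendsto_const LIMSEQ_inverse_real_of_nat, of m] by simp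
  qed (use s m_le in \<open>auto intro!: always_eventually less_imp_le\<close>)
  have "Cauchy s"
  proof (rule metric_CauchyI)
    fix e :: real assume "e > 0"
    \<comment> \<open>Two values within \<mu>/8 * e^2 of the infimum leave at most \<mu>/4 * e^2 for
      the quadratic term of the midpoint inequality.\<close>
    with \<mu> have "\<mu> / 8 * e\<^sup>2 > 0" by simp
    from order_tendstoD(2)[OF lim, of "m + \<mu> / 8 * e\<^sup>2"] this
    obtain N where N: "\<And>n. n \<ge> N \<Longrightarrow> \<Phi> (s n) < m + \<mu> / 8 * e\<^sup>2"
      by (auto simp: eventually_sequentially)
    have "dist (s i) (s j) < e" if "i \<ge> N" "j \<ge> N" for i j
    proof -
      have "\<mu> / 4 * (norm (s i - s j))\<^sup>2 < \<mu> / 4 * e\<^sup>2"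
        using strong_subgradient_midpoint[OF sub, of "s i" "s j"] m_le[of "midpoint (s i) (s j)"]
          N[OF that(1)] N[OF that(2)] by linarith
      with \<mu> have "(norm (s i - s j))\<^sup>2 < e\<^sup>2" by simp
      with \<open>e > 0\<close> show ?thesis by (simp add: dist_norm power2_less_imp_less)
    qed
    then show "\<exists>N. \<forall>i\<ge>N. \<forall>j\<ge>N. dist (s i) (s j) < e" by blast
  qed
  then obtain z where z: "s \<longlonglongrightarrow> z"
    using Cauchy_convergent_iff convergent_def by blast
  have "(\<lambda>n. \<Phi> (s n)) \<longlonglongrightarrow> \<Phi> z"
    using continuous_on_tendsto_compose[OF cont z] by simp
  with lim have "\<Phi> z = m" using LIMSEQ_unique by blast
  with m_le show ?thesis by (intro that[of z]) simp
qed

text \<open>The midpoint of two distinct minimizers would have a smaller value.\<close>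

lemma argmin_set_strong_subgradient:
  fixes \<Phi> :: "'a::real_inner \<Rightarrow> real"
  assumes "strong_subgradient \<mu> \<Phi> g" "\<mu> > 0" "\<And>y. \<Phi> z \<le> \<Phi> y"
  shows "argmin_set \<Phi> = {z}"
proof -
  have "w = z" if w: "\<And>y. \<Phi> w \<le> \<Phi> y" for w
  proof -
    have "\<mu> / 4 * (norm (w - z))\<^sup>2 \<le> 0"
      using strong_subgradient_midpoint[OF assms(1), of w z] w[of "midpoint w z"]
        assms(3)[of "midpoint w z"] by linarith
    with \<open>\<mu> > 0\<close> show ?thesis by (simp add: mult_le_0_iff)
  qed
  with assms(3) show ?thesis by (auto simp: argmin_set_def)
qed

text \<open>The sign of the Lyapunov derivative as pure inner product algebra: \<open>z\<close>,
  \<open>v\<close>, \<open>g\<close>, \<open>W\<close> stand for the displacement from the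
  minimizer, the velocity, the gradient and the gap in \<Phi>. The positive factor
  \<open>t powr (p - 1)\<close> has been divided out.\<close>

lemma lyapunov_deriv_nonpos:
  fixes z v g :: "'a::real_inner"
  assumes \<alpha>: "\<alpha> > 3" and \<theta>: "\<theta> = 2 / 3 * \<alpha>" and p: "p = \<theta> - 2" and c: "c = \<theta> * (\<alpha> / 3 - 1) / 2"
    and t: "t > 0" "p * \<theta> \<le> \<mu> * t\<^sup>2"
    and sub: "inner g z \<ge> W + \<mu> / 2 * inner z z"
  shows "p * (t\<^sup>2 * W + inner (\<theta> *\<^sub>R z + t *\<^sub>R v) (\<theta> *\<^sub>R z + t *\<^sub>R v) / 2 - c * inner z z)
    + t * (2 * t * W + t\<^sup>2 * inner g v
      + inner (\<theta> *\<^sub>R z + t *\<^sub>R v) ((\<theta> + 1 - \<alpha>) *\<^sub>R v - t *\<^sub>R g) - 2 * c * inner z v) \<le> 0"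
    (is "?L \<le> 0")
proof -
  have "\<theta> > 0" using \<alpha> \<theta> by simp
  then have "c \<ge> 0" using \<alpha> unfolding c by simp
  have comm: "inner v z = inner z v" "inner z g = inner g z" "inner v g = inner g v"
    by (simp_all add: inner_commute)
  \<comment> \<open>The choices of \<theta> and \<open>p\<close> remove \<open>inner v v\<close>,
    that of \<open>c\<close> removes \<open>inner z v\<close>, and the \<open>inner g v\<close>
    terms cancel. Inserting \<mu>/2 * \<open>inner z z\<close> splits the rest into three terms,
    signed by \<open>sub\<close>, by the size of \<open>t\<close>, and by \<alpha> > 3.\<close>
  have "?L = \<theta> * t\<^sup>2 * (W + \<mu> / 2 * inner z z - inner g z)
      + \<theta> / 2 * (p * \<theta> - \<mu> * t\<^sup>2) * inner z z - p * c * inner z z"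
    unfolding c p \<theta> inner_add_left inner_add_right inner_diff_left inner_diff_right
      inner_scaleR_left inner_scaleR_right comm
    by (simp add: field_simps power2_eq_square power3_eq_cube)
  moreover have "\<theta> * t\<^sup>2 * (W + \<mu> / 2 * inner z z - inner g z) \<le> 0"
    using sub \<open>\<theta> > 0\<close> by (intro mult_nonneg_nonpos) auto
  moreover have "\<theta> / 2 * (p * \<theta> - \<mu> * t\<^sup>2) * inner z z \<le> 0"
    using t(2) \<open>\<theta> > 0\<close> by (intro mult_nonpos_nonneg[OF mult_nonneg_nonpos]) auto
  moreover have "p * c * inner z z \<ge> 0"
    using \<alpha> \<theta> p \<open>c \<ge> 0\<close> by (intro mult_nonneg_nonneg) auto
  ultimately show ?thesis by linarith
qed

lemma bigo_powrI:
  fixes f :: "real \<Rightarrow> real"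
  assumes "\<And>t. t \<ge> T \<Longrightarrow> 0 \<le> f t" "\<And>t. t \<ge> T \<Longrightarrow> f t \<le> C * t powr a"
  shows "f \<in> O[at_top](\<lambda>t. t powr a)"
proof (rule bigoI[of _ C])
  show "\<forall>\<^sub>F t in at_top. norm (f t) \<le> C * norm (t powr a)"
    using eventually_ge_at_top[of T] by eventually_elim (use assms in auto)
qed

theorem theorem3p4:
  fixes \<Phi> :: "'a::{real_inner, complete_space} \<Rightarrow> real"
    and x x' x'' :: "real \<Rightarrow> 'a"
    and t0 \<alpha> :: real
  assumes "continuously_differentiable \<Phi>"
    and "strongly_convex \<Phi>"
    and "t0 > 0"
    and "\<alpha> > 3"
    and "C2_on_halfline t0 x x' x''"
    and "\<forall>t\<ge>t0. x'' t + (\<alpha> / t) *\<^sub>R x' t + gradient \<Phi> (x t) = 0"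
  shows "\<exists>xs. argmin_set \<Phi> = {xs} \<and>
    (x \<longlongrightarrow> xs) at_top \<and>
    (\<lambda>t. \<Phi> (x t) - \<Phi> xs) \<in> O[at_top](\<lambda>t. t powr (- (2 / 3) * \<alpha>)) \<and>
    (\<lambda>t. (norm (x t - xs))\<^sup>2) \<in> O[at_top](\<lambda>t. t powr (- (2 / 3) * \<alpha>)) \<and>
    (\<lambda>t. (norm (x' t))\<^sup>2) \<in> O[at_top](\<lambda>t. t powr (- (2 / 3) * \<alpha>))"
proof -

  \<comment> \<open>The minimizer and quadratic growth around it\<close>
  obtain \<mu> where \<mu>: "\<mu> > 0" and sub: "strong_subgradient \<mu> \<Phi> (gradient \<Phi>)"
    using assms(2) by (auto simp: strongly_convex_def strong_subgradient_def)
  obtain D where D: "\<And>u. (\<Phi> has_derivative blinfun_apply (D u)) (at u)"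
    using assms(1) by (auto simp: continuously_differentiable_def)
  (* Strong convexity makes the vector chosen by gradient a subgradient whether or not it is a
     gradient; Frechet differentiability then identifies the two, so Riesz is not needed. *)
  have grad: "GDERIV \<Phi> u :> gradient \<Phi> u" for u
  proof (rule GDERIV_subgradient[OF D])
    show "\<Phi> u + inner (gradient \<Phi> u) (y - u) \<le> \<Phi> y" for y
    proof -
      have "0 \<le> \<mu> / 2 * (norm (u - y))\<^sup>2" using \<mu> by simp
      then show ?thesis using strong_subgradientD[OF sub, of u y] by linarith
    qed
  qed
  have "continuous_on UNIV \<Phi>"
    by (intro continuous_at_imp_continuous_on ballI has_derivative_continuous[OF D])
  from strong_subgradient_ex_minimizer[OF sub \<mu> this]
  obtain xs where xs: "\<And>y. \<Phi> xs \<le> \<Phi> y" by blast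
  have grad_xs: "gradient \<Phi> xs = 0"
    by (rule gradient_eqI, rule GDERIV_subgradient[OF D]) (simp add: xs)
  have quad: "\<mu> / 2 * (norm (u - xs))\<^sup>2 \<le> \<Phi> u - \<Phi> xs" for u
    using strong_subgradientD[OF sub, of xs u] by (simp add: grad_xs norm_minus_commute)

  \<comment> \<open>The Lyapunov function and the threshold time\<close>
  define \<theta> where "\<theta> = 2 / 3 * \<alpha>"
  define p where "p = \<theta> - 2"
  define c where "c = \<theta> * (\<alpha> / 3 - 1) / 2"
  have pos: "\<theta> > 0" "p > 0" "c > 0"
    using \<open>\<alpha> > 3\<close> by (auto simp: \<theta>_def p_def c_def)
  define W where "W t = \<Phi> (x t) - \<Phi> xs" for t
  define z where "z t = x t - xs" for t
  define v where "v t = \<theta> *\<^sub>R z t + t *\<^sub>R x' t" for t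
  define G where "G t = t\<^sup>2 * W t + inner (v t) (v t) / 2 - c * inner (z t) (z t)" for t
  define F where "F t = t powr p * G t" for t
  \<comment> \<open>The entry 1 gives t \<le> t^2, so the last two entries yield the quadratic
    bounds in \<open>big\<close>: one for the sign of the derivative, one to control the subtracted
    term. The entry \<open>t0 + 1\<close> keeps \<open>t\<close> interior, where derivatives are
    two-sided.\<close>
  define T where "T = Max {1, t0 + 1, p * \<theta> / \<mu>, 4 * c / \<mu>}"
  have T: "1 \<le> T" "t0 < T" "p * \<theta> / \<mu> \<le> T" "4 * c / \<mu> \<le> T"
    by (auto simp: T_def)
  have big: "p * \<theta> \<le> \<mu> * t\<^sup>2" "4 * c \<le> \<mu> * t\<^sup>2" if "t \<ge> T" for t
  proof -
    have "t \<le> t\<^sup>2" using that T by (simp add: power2_eq_square)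
    then have "p * \<theta> / \<mu> \<le> t\<^sup>2" "4 * c / \<mu> \<le> t\<^sup>2" using that T by auto
    with \<mu> show "p * \<theta> \<le> \<mu> * t\<^sup>2" "4 * c \<le> \<mu> * t\<^sup>2" by (auto simp: field_simps)
  qed

  \<comment> \<open>Monotonicity of the Lyapunov function along the trajectory\<close>
  have F_deriv: "\<exists>d. (F has_real_derivative d) (at t) \<and> d \<le> 0" if t: "t \<ge> T" for t
  proof -
    have t0: "t > t0" "t > 0" using t T \<open>t0 > 0\<close> by auto
    have at: "at t within {t0..} = at t"
      by (rule at_within_interior) (use t0 in auto)
    have dx: "(x has_vector_derivative x' t) (at t)" and dx': "(x' has_vector_derivative x'' t) (at t)"
      using assms(5) t0(1) unfolding C2_on_halfline_def by (metis at less_imp_le)+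
    let ?g = "gradient \<Phi> (x t)"
    have ode: "x'' t = - ((\<alpha> / t) *\<^sub>R x' t) - ?g"
      using assms(6) t0 by (simp add: eq_neg_iff_add_eq_0 algebra_simps)
    have dW: "(W has_real_derivative inner ?g (x' t)) (at t)"
    proof -
      have "((\<Phi> \<circ> x) has_derivative (\<lambda>v. inner v ?g) \<circ> (\<lambda>s. s *\<^sub>R x' t)) (at t)"
        using dx grad[of "x t"] unfolding has_vector_derivative_def gderiv_def by (rule diff_chain_at)
      then have "((\<lambda>s. \<Phi> (x s)) has_real_derivative inner ?g (x' t)) (at t)"
        by (simp add: has_field_derivative_def o_def inner_commute mult.commute[of _ "inner _ _"])
      then show ?thesis unfolding W_def by (auto intro!: derivative_eq_intros)
    qed
    have dz: "(z has_vector_derivative x' t) (at t)"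
      unfolding z_def by (auto intro!: derivative_eq_intros dx)
    \<comment> \<open>The factor \<open>t\<close> in front of \<open>x'\<close> cancels the 1/t of
      the damping once the equation eliminates \<open>x''\<close>.\<close>
    have dv: "(v has_vector_derivative (\<theta> + 1 - \<alpha>) *\<^sub>R x' t - t *\<^sub>R ?g) (at t)"
    proof -
      have "(v has_vector_derivative \<theta> *\<^sub>R x' t + (t *\<^sub>R x'' t + 1 *\<^sub>R x' t)) (at t)"
        unfolding v_def
        by (intro has_vector_derivative_add has_vector_derivative_scaleR dx' DERIV_ident
            bounded_linear.has_vector_derivative[OF bounded_linear_scaleR_right dz])
      also have "\<theta> *\<^sub>R x' t + (t *\<^sub>R x'' t + 1 *\<^sub>R x' t) = (\<theta> + 1 - \<alpha>) *\<^sub>R x' t - t *\<^sub>R ?g"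
        unfolding ode using t0 by (simp add: algebra_simps)
      finally show ?thesis .
    qed
    have inner_self: "((\<lambda>s. inner (f s) (f s)) has_real_derivative 2 * inner (f t) f') (at t)"
      if "(f has_vector_derivative f') (at t)" for f :: "real \<Rightarrow> 'a" and f'
    proof -
      have "((\<lambda>s. inner (f s) (f s)) has_derivative
          (\<lambda>h. inner (f t) (h *\<^sub>R f') + inner (h *\<^sub>R f') (f t))) (at t)"
        using that unfolding has_vector_derivative_def by (intro has_derivative_inner) auto
      also have "(\<lambda>h. inner (f t) (h *\<^sub>R f') + inner (h *\<^sub>R f') (f t)) = (*) (2 * inner (f t) f')"
        by (simp add: inner_commute[of f'] fun_eq_iff)
      finally show ?thesis unfolding has_field_derivative_def .
    qed
    let ?G' = "2 * t * W t + t\<^sup>2 * inner ?g (x' t)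
      + inner (v t) ((\<theta> + 1 - \<alpha>) *\<^sub>R x' t - t *\<^sub>R ?g) - 2 * c * inner (z t) (x' t)"
    have dG: "(G has_real_derivative ?G') (at t)"
      unfolding G_def by (auto intro!: derivative_eq_intros dW inner_self[OF dv] inner_self[OF dz])
    have "(F has_real_derivative (p * t powr (p - 1) * G t + t powr p * ?G')) (at t)"
      unfolding F_def using t0
      by (auto intro!: derivative_eq_intros dG simp: algebra_simps)
    moreover have "p * t powr (p - 1) * G t + t powr p * ?G' = t powr (p - 1) * (p * G t + t * ?G')"
      using t0 by (simp add: powr_diff field_simps)
    moreover have "p * G t + t * ?G' \<le> 0"
      unfolding G_def v_def
    proof (rule lyapunov_deriv_nonpos[OF \<open>\<alpha> > 3\<close> \<theta>_def p_def c_def \<open>t > 0\<close> big(1)[OF t]])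
      have "inner ?g (xs - x t) = - inner ?g (z t)"
        by (simp add: z_def inner_diff_right)
      then show "W t + \<mu> / 2 * inner (z t) (z t) \<le> inner ?g (z t)"
        using strong_subgradientD[OF sub, of "x t" xs]
        by (simp add: W_def z_def power2_norm_eq_inner)
    qed
    ultimately show ?thesis
      by (intro exI[of _ "p * t powr (p - 1) * G t + t powr p * ?G'"] conjI) (auto intro: mult_nonneg_nonpos)
  qed
  have F_le: "F t \<le> F T" if "t \<ge> T" for t
    by (rule DERIV_nonpos_imp_nonincreasing[OF that]) (use F_deriv in blast)

  \<comment> \<open>Decay rates from boundedness\<close>
  define C where "C = 2 * \<bar>F T\<bar>"
  \<comment> \<open>Since p + 2 = \<theta>, the weight of the gap is t^\<theta>, whose inverse is
    exactly the claimed rate.\<close>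
  have powr: "t powr (- (2 / 3) * \<alpha>) = inverse (t powr p * t\<^sup>2)" if "t > 0" for t
  proof -
    have "t powr p * t\<^sup>2 = t powr \<theta>"
      using that by (simp add: p_def powr_diff)
    then show ?thesis by (simp add: \<theta>_def powr_minus[symmetric])
  qed
  \<comment> \<open>By quadratic growth the subtracted term costs at most half of
    \<open>t\<^sup>2 * W t\<close>; the factor 2 in \<open>C\<close> makes up for the remaining
    halves.\<close>
  have E: "t powr p * (t\<^sup>2 * W t + (norm (v t))\<^sup>2) \<le> C" if t: "t \<ge> T" for t
  proof -
    have "c * (norm (z t))\<^sup>2 \<le> (\<mu> * t\<^sup>2 / 4) * (norm (z t))\<^sup>2"
      using big(2)[OF t] by (intro mult_right_mono) auto
    also have "\<dots> = t\<^sup>2 / 2 * (\<mu> / 2 * (norm (z t))\<^sup>2)" by simp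
    also have "\<dots> \<le> t\<^sup>2 / 2 * W t"
      unfolding z_def W_def by (intro mult_left_mono quad) auto
    finally have "(t\<^sup>2 * W t + (norm (v t))\<^sup>2) / 2 \<le> G t"
      by (simp add: G_def power2_norm_eq_inner mult.commute)
    then have "t powr p * ((t\<^sup>2 * W t + (norm (v t))\<^sup>2) / 2) \<le> F t"
      unfolding F_def by (intro mult_left_mono) auto
    with F_le[OF t] show ?thesis by (simp add: C_def)
  qed
  let ?r = "\<lambda>t. t powr (- (2 / 3) * \<alpha>)"
  have W_nonneg: "W t \<ge> 0" for t by (simp add: W_def xs)
  have E': "t\<^sup>2 * W t + (norm (v t))\<^sup>2 \<le> C * t\<^sup>2 * ?r t" if t: "t \<ge> T" for t
  proof -
    have "t > 0" using t T by simp
    then show ?thesis unfolding powr[OF \<open>t > 0\<close>] using E[OF t] by (simp add: field_simps)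
  qed
  have W_le: "W t \<le> C * ?r t" if t: "t \<ge> T" for t
  proof -
    have "t\<^sup>2 * W t \<le> C * t\<^sup>2 * ?r t"
      using E'[OF t] zero_le_power2[of "norm (v t)"] by linarith
    also have "\<dots> = t\<^sup>2 * (C * ?r t)" by simp
    finally have "t\<^sup>2 * W t \<le> t\<^sup>2 * (C * ?r t)" .
    moreover have "t\<^sup>2 > 0" using t T by simp
    ultimately show ?thesis by (simp only: mult_le_cancel_left_pos)
  qed
  have z_le: "(norm (z t))\<^sup>2 \<le> 2 * C / \<mu> * ?r t" if t: "t \<ge> T" for t
  proof -
    have "\<mu> / 2 * (norm (z t))\<^sup>2 \<le> C * ?r t"
      using quad[of "x t"] W_le[OF t] by (simp add: z_def W_def)
    with \<mu> show ?thesis by (simp add: field_simps)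
  qed
  \<comment> \<open>The velocity is recovered from \<open>t x' = v - \<theta> z\<close>, with both
    terms on the right already estimated.\<close>
  have x'_le: "(norm (x' t))\<^sup>2 \<le> (2 * C + 2 * \<theta>\<^sup>2 * (2 * C / \<mu>)) * ?r t" if t: "t \<ge> T" for t
  proof -
    have t1: "t \<ge> 1" "t > 0" using t T by auto
    then have t2: "1 \<le> t\<^sup>2" by (simp add: power2_eq_square mult_ge1_I)
    have "t * norm (x' t) = norm (v t - \<theta> *\<^sub>R z t)"
      using t1 by (simp add: v_def)
    also have "\<dots> \<le> norm (v t) + \<theta> * norm (z t)"
      using norm_triangle_ineq4[of "v t" "\<theta> *\<^sub>R z t"] pos by simp
    finally have "(t * norm (x' t))\<^sup>2 \<le> (norm (v t) + \<theta> * norm (z t))\<^sup>2"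
      using t1 by (intro power_mono) auto
    also have "\<dots> \<le> 2 * (norm (v t))\<^sup>2 + 2 * \<theta>\<^sup>2 * (norm (z t))\<^sup>2"
      using zero_le_power2[of "norm (v t) - \<theta> * norm (z t)"]
      by (simp add: power2_eq_square algebra_simps)
    also have "\<dots> \<le> 2 * (C * t\<^sup>2 * ?r t) + 2 * \<theta>\<^sup>2 * (t\<^sup>2 * (2 * C / \<mu> * ?r t))"
    proof (intro add_mono mult_left_mono)
      show "(norm (v t))\<^sup>2 \<le> C * t\<^sup>2 * ?r t"
        using E'[OF t] mult_nonneg_nonneg[OF zero_le_power2 W_nonneg, of t t] by linarith
      \<comment> \<open>The estimate for \<open>z\<close> is better than required; it is weakened by
        t^2 \<ge> 1 so that t^2 can be divided out of both terms.\<close>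
      have "(norm (z t))\<^sup>2 \<le> t\<^sup>2 * (norm (z t))\<^sup>2"
        using mult_right_mono[OF t2, of "(norm (z t))\<^sup>2"] by simp
      also have "\<dots> \<le> t\<^sup>2 * (2 * C / \<mu> * ?r t)" by (intro mult_left_mono z_le t) auto
      finally show "(norm (z t))\<^sup>2 \<le> t\<^sup>2 * (2 * C / \<mu> * ?r t)" .
    qed auto
    also have "\<dots> = t\<^sup>2 * ((2 * C + 2 * \<theta>\<^sup>2 * (2 * C / \<mu>)) * ?r t)"
      by (simp add: algebra_simps)
    finally have "t\<^sup>2 * (norm (x' t))\<^sup>2 \<le> t\<^sup>2 * ((2 * C + 2 * \<theta>\<^sup>2 * (2 * C / \<mu>)) * ?r t)"
      by (simp only: power_mult_distrib)
    moreover have "t\<^sup>2 > 0" using t1 by simp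
    ultimately show ?thesis by (simp only: mult_le_cancel_left_pos)
  qed

  \<comment> \<open>Strong convergence and conclusion\<close>
  have "((\<lambda>t. (norm (x t - xs))\<^sup>2) \<longlongrightarrow> 0) at_top"
  proof (rule tendsto_sandwich[of "\<lambda>_. 0"])
    show "\<forall>\<^sub>F t in at_top. (norm (x t - xs))\<^sup>2 \<le> 2 * C / \<mu> * ?r t"
      using eventually_ge_at_top[of T] by eventually_elim (use z_le in \<open>simp add: z_def\<close>)
    have "(?r \<longlongrightarrow> 0) at_top"
      using \<open>\<alpha> > 3\<close> by (intro tendsto_neg_powr filterlim_ident) auto
    then show "((\<lambda>t. 2 * C / \<mu> * ?r t) \<longlongrightarrow> 0) at_top"
      by (rule tendsto_mult_right_zero)
  qed auto
  then have "((\<lambda>t. norm (x t - xs)) \<longlongrightarrow> 0) at_top"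
    using tendsto_real_sqrt[of "\<lambda>t. (norm (x t - xs))\<^sup>2" 0 at_top] by simp
  then have "(x \<longlongrightarrow> xs) at_top"
    by (rule LIM_zero_cancel[OF tendsto_norm_zero_cancel])
  moreover have "(\<lambda>t. \<Phi> (x t) - \<Phi> xs) \<in> O[at_top](?r)"
    by (rule bigo_powrI[of T _ C]) (use xs W_le in \<open>auto simp: W_def\<close>)
  moreover have "(\<lambda>t. (norm (x t - xs))\<^sup>2) \<in> O[at_top](?r)"
    by (rule bigo_powrI[of T _ "2 * C / \<mu>"]) (use z_le in \<open>auto simp: z_def\<close>)
  moreover have "(\<lambda>t. (norm (x' t))\<^sup>2) \<in> O[at_top](?r)"
    by (rule bigo_powrI[OF _ x'_le]) auto
  ultimately show ?thesis
    using argmin_set_strong_subgradient[OF sub \<mu> xs] by blast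
qed

end
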